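(* Let $K$ be a field, $S=K[x_1,\ldots,x_n]$, and let $I\subset S$ be a squarefree monomial ideal, minimally generated by three monomials. Then $\operatorname{slength}(I)\leq n+1$.
   Context: Let $M$ be a finitely generated $\mathbb Z^n$-graded $S$-module, $S=K[x_1,\ldots,x_n]$. A Stanley decomposition of $M$ is a finite direct sum of $K$-vector spaces $\mathcal D: M=\bigoplus_{i=1}^r m_iK[Z_i]$, where each $m_i\in M$ is homogeneous, $Z_i\subset\{x_1,\ldots,x_n\}$, and $m_iK[Z_i]$ is a free $K[Z_i]$-module. Its length is $\operatorname{slength}(\mathcal D)=r$, and the Stanley length of $M$ is $\operatorname{slength}(M)=\min\{\operatorname{slength}(\mathcal D):\mathcal D\text{ is a Stanley decomposition of }M\}$. *)

theory Defs
  imports "HOL-Library.Poly_Mapping" "HOL-Library.Extended_Nat" "HOL-Library.Cardinality"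
begin

text \<open>
  The polynomial ring over \<open>'k\<close> in the variables \<open>'n\<close> is the monoid algebra of the exponent
  vectors \<open>'n \<Rightarrow>\<^sub>0 nat\<close>; the number of variables is \<open>CARD('n)\<close>.
\<close>

type_synonym 'n exponent = "'n \<Rightarrow>\<^sub>0 nat"
type_synonym ('n, 'k) polynomial = "('n \<Rightarrow>\<^sub>0 nat) \<Rightarrow>\<^sub>0 'k"

definition monom :: "'n exponent \<Rightarrow> ('n, 'k::field) polynomial" where
  "monom t = Poly_Mapping.single t 1"

definition poly_subring :: "'n set \<Rightarrow> ('n, 'k::field) polynomial set" where
  "poly_subring Z = {f. \<forall>t\<in>Poly_Mapping.keys f. Poly_Mapping.keys t \<subseteq> Z}"

subsection \<open>Monomial ideals\<close>

text \<open>An ideal is a submodule of the ring acting on itself by multiplication.\<close>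

interpretation ideal: module "(*) :: 'a::comm_ring_1 \<Rightarrow> 'a \<Rightarrow> 'a"
  by standard (simp_all add: algebra_simps)

definition squarefree_exponent :: "'n exponent \<Rightarrow> bool" where
  "squarefree_exponent t \<longleftrightarrow> (\<forall>i. Poly_Mapping.lookup t i \<le> 1)"

definition squarefree_monomial_ideal :: "('n, 'k::field) polynomial set \<Rightarrow> bool" where
  "squarefree_monomial_ideal I \<longleftrightarrow>
     (\<exists>T. (\<forall>t\<in>T. squarefree_exponent t) \<and> I = ideal.span (monom ` T))"

definition minimally_generated_by_monomials ::
    "('n, 'k::field) polynomial set \<Rightarrow> ('n, 'k) polynomial set \<Rightarrow> bool" where
  "minimally_generated_by_monomials I G \<longleftrightarrow>
     G \<subseteq> range monom \<and> ideal.span G = I \<and> (\<forall>G'. G' \<subset> G \<longrightarrow> ideal.span G' \<noteq> I)"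

subsection \<open>Stanley decompositions\<close>

text \<open>
  A \<open>\<int>\<^sup>n\<close>-graded module is given by its scalar multiplication \<open>scale\<close>, its underlying set \<open>M\<close>
  and the family \<open>gr\<close> of its homogeneous components. The spaces \<open>m K[Z]\<close> are the
  sets \<open>stanley_space scale (m, Z)\<close>.
\<close>

definition stanley_space ::
    "(('n, 'k::field) polynomial \<Rightarrow> 'm \<Rightarrow> 'm) \<Rightarrow> 'm \<times> 'n set \<Rightarrow> 'm set" where
  "stanley_space scale = (\<lambda>(m, Z). (\<lambda>f. scale f m) ` poly_subring Z)"

text \<open>
  The last conjunct says that \<open>M\<close> is the internal direct sum of the spaces in the list: the
  addition map from their product to \<open>M\<close> is a bijection. Since \<open>m K[Z]\<close> is cyclic,
  it is free over \<open>K[Z]\<close> (and nonzero) iff no nonzero element of \<open>K[Z]\<close> annihilates \<open>m\<close>.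
\<close>

definition stanley_decomposition ::
    "(('n, 'k::field) polynomial \<Rightarrow> 'm \<Rightarrow> 'm) \<Rightarrow> 'm::ab_group_add set \<Rightarrow>
     (('n \<Rightarrow> int) \<Rightarrow> 'm set) \<Rightarrow> ('m \<times> 'n set) list \<Rightarrow> bool" where
  "stanley_decomposition scale M gr D \<longleftrightarrow>
     (\<forall>(m, Z)\<in>set D. m \<in> M \<and> (\<exists>a. m \<in> gr a) \<and>
        (\<forall>f\<in>poly_subring Z. scale f m = 0 \<longrightarrow> f = 0)) \<and>
     bij_betw sum_list (listset (map (stanley_space scale) D)) M"

text \<open>
  The minimum is taken in \<open>enat\<close>, so that a module without Stanley decompositions has
  infinite Stanley length (on \<open>nat\<close>, the infimum of the empty set would be 0).
\<close>

definition slength ::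
    "(('n, 'k::field) polynomial \<Rightarrow> 'm \<Rightarrow> 'm) \<Rightarrow> 'm::ab_group_add set \<Rightarrow>
     (('n \<Rightarrow> int) \<Rightarrow> 'm set) \<Rightarrow> enat" where
  "slength scale M gr = (INF D \<in> {D. stanley_decomposition scale M gr D}. enat (length D))"

definition polynomial_component :: "('n \<Rightarrow> int) \<Rightarrow> ('n, 'k::field) polynomial set" where
  "polynomial_component a =
     {f. \<forall>t\<in>Poly_Mapping.keys f. \<forall>i. int (Poly_Mapping.lookup t i) = a i}"

definition ideal_slength :: "('n, 'k::field) polynomial set \<Rightarrow> enat" where
  "ideal_slength I = slength (*) I (\<lambda>a. I \<inter> polynomial_component a)"

end

theory Submission
  imports Defs
begin

text \<open>
  Let \<open>A\<close>, \<open>B\<close>, \<open>C\<close> be the supports of the three generators. A monomial lies in \<open>I\<close> iff its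
  support \<open>X\<close> contains one of these sets. Either \<open>X\<close> contains all of them, or exactly one of the
  cyclic conditions \<open>A \<subseteq> X \<and> \<not> B \<subseteq> X\<close>, \<open>B \<subseteq> X \<and> \<not> C \<subseteq> X\<close>, \<open>C \<subseteq> X \<and> \<not> A \<subseteq> X\<close> holds. The
  monomials of the first kind form one Stanley space; those with \<open>A \<subseteq> X \<and> \<not> B \<subseteq> X\<close> are sorted by
  the first element of \<open>B - A\<close> missing from \<open>X\<close>, which gives \<open>card (B - A)\<close> Stanley spaces. As
  \<open>B - A\<close>, \<open>C - B\<close> and \<open>A - C\<close> are disjoint, at most \<open>n + 1\<close> spaces are used.
\<close>

section \<open>Polynomials with prescribed support\<close>

text \<open>Monomial ideals and Stanley spaces of monomials both take this form
  (\<open>ideal_span_monom\<close>, \<open>stanley_space_monom\<close>), so direct sums reduce to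
  partitions of sets of exponents.\<close>

definition supported_on :: "'a set \<Rightarrow> ('a \<Rightarrow>\<^sub>0 'b::zero) set" where
  "supported_on T = {f. Poly_Mapping.keys f \<subseteq> T}"

lemma poly_mapping_eq_sum_single:
  "(\<Sum>k\<in>Poly_Mapping.keys f. Poly_Mapping.single k (Poly_Mapping.lookup f k)) = f"
  by (rule poly_mapping_eqI)
    (simp add: lookup_sum lookup_single when_def sum.delta in_keys_iff)

lemma supported_on_split:
  fixes f :: "'a \<Rightarrow>\<^sub>0 'b::comm_monoid_add"
  assumes "f \<in> supported_on (S \<union> T)"
  obtains g h where "g \<in> supported_on S" "h \<in> supported_on T" "f = g + h"
proof -
  let ?m = "\<lambda>k. Poly_Mapping.single k (Poly_Mapping.lookup f k)"
  let ?K = "Poly_Mapping.keys f"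
  have "f = sum ?m (?K \<inter> S) + sum ?m (?K - S)"
    using sum.Int_Diff[of ?K ?m S] by (simp add: poly_mapping_eq_sum_single)
  moreover have "sum ?m (?K \<inter> S) \<in> supported_on S"
    using keys_sum[of ?m "?K \<inter> S"] by (fastforce simp: supported_on_def split: if_splits)
  moreover have "sum ?m (?K - S) \<in> supported_on T"
    using keys_sum[of ?m "?K - S"] assms
    by (fastforce simp: supported_on_def split: if_splits)
  ultimately show ?thesis using that by blast
qed

lemma supported_on_add:
  "g \<in> supported_on S \<Longrightarrow> h \<in> supported_on T \<Longrightarrow> g + h \<in> supported_on (S \<union> T)"
  using keys_add[of g h] by (auto simp: supported_on_def)

text \<open>Uniqueness in direct sums: at an exponent in \<open>S\<close> the summands from
  \<open>T\<close> vanish, and outside \<open>S\<close> those from \<open>S\<close> vanish.\<close>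

lemma supported_on_add_cancel:
  fixes g h :: "'a \<Rightarrow>\<^sub>0 'b::cancel_comm_monoid_add"
  assumes "g \<in> supported_on S" "g' \<in> supported_on S"
    and "h \<in> supported_on T" "h' \<in> supported_on T"
    and "S \<inter> T = {}" and eq: "g + h = g' + h'"
  shows "g = g' \<and> h = h'"
proof -
  have "Poly_Mapping.lookup g k = Poly_Mapping.lookup g' k" for k
  proof (cases "k \<in> S")
    case True
    then have "Poly_Mapping.lookup h k = 0" "Poly_Mapping.lookup h' k = 0"
      using assms by (auto simp: supported_on_def in_keys_iff)
    then show ?thesis
      using arg_cong[OF eq, of "\<lambda>f. Poly_Mapping.lookup f k"] by (simp add: lookup_add)
  next
    case False
    then have "k \<notin> Poly_Mapping.keys g" "k \<notin> Poly_Mapping.keys g'"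
      using assms by (auto simp: supported_on_def)
    then show ?thesis by (simp add: in_keys_iff)
  qed
  then have "g = g'" by (rule poly_mapping_eqI)
  with eq show ?thesis by simp
qed

text \<open>Provides the bijection that \<open>stanley_decomposition\<close> asks for. In the
  induction \<open>T\<close> is disjoint from the union of the remaining sets, so
  \<open>supported_on_add_cancel\<close> yields injectivity and \<open>supported_on_split\<close>
  surjectivity.\<close>

lemma bij_betw_sum_list_supported_on:
  fixes Ts :: "'a set list"
  assumes "sorted_wrt (\<lambda>S T. S \<inter> T = {}) Ts"
  shows "bij_betw sum_list
    (listset (map supported_on Ts) :: ('a \<Rightarrow>\<^sub>0 'b::cancel_comm_monoid_add) list set)
    (supported_on (\<Union>(set Ts)))"
  using assms
proof (induction Ts)
  case Nil
  show ?case by (auto simp: bij_betw_def supported_on_def)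
next
  case (Cons T Ts)
  let ?L = "listset (map supported_on Ts) :: ('a \<Rightarrow>\<^sub>0 'b) list set"
  let ?U = "\<Union>(set Ts)"
  have IH: "inj_on sum_list ?L" "sum_list ` ?L = supported_on ?U"
    using Cons by (auto simp: bij_betw_def)
  have disj: "T \<inter> ?U = {}" using Cons.prems by auto
  have "inj_on sum_list (set_Cons (supported_on T) ?L)"
  proof (rule inj_onI)
    fix xs ys
    assume "xs \<in> set_Cons (supported_on T) ?L" "ys \<in> set_Cons (supported_on T) ?L"
      and eq: "sum_list xs = sum_list ys"
    then obtain g gs h hs where xs: "xs = g # gs" "g \<in> supported_on T" "gs \<in> ?L"
      and ys: "ys = h # hs" "h \<in> supported_on T" "hs \<in> ?L"
      by (auto simp: set_Cons_def)
    have "sum_list gs \<in> supported_on ?U" "sum_list hs \<in> supported_on ?U"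
      using IH xs ys by blast+
    then have "g = h \<and> sum_list gs = sum_list hs"
      using supported_on_add_cancel[OF xs(2) ys(2) _ _ disj] eq xs ys by simp
    with IH(1) xs ys show "xs = ys" by (auto dest: inj_onD)
  qed
  moreover have "sum_list ` set_Cons (supported_on T) ?L = supported_on (T \<union> ?U)"
  proof (intro equalityI subsetI)
    fix f assume "f \<in> sum_list ` set_Cons (supported_on T) ?L"
    then obtain g gs where "f = g + sum_list gs" "g \<in> supported_on T" "gs \<in> ?L"
      by (auto simp: set_Cons_def)
    with IH(2) show "f \<in> supported_on (T \<union> ?U)" by (blast intro: supported_on_add)
  next
    fix f :: "'a \<Rightarrow>\<^sub>0 'b"
    assume "f \<in> supported_on (T \<union> ?U)"
    then obtain g h where gh: "g \<in> supported_on T" "h \<in> supported_on ?U" "f = g + h"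
      by (rule supported_on_split)
    then obtain gs where "gs \<in> ?L" "h = sum_list gs" using IH(2) by blast
    with gh have "f = sum_list (g # gs)" "g # gs \<in> set_Cons (supported_on T) ?L"
      by (auto simp: set_Cons_def)
    then show "f \<in> sum_list ` set_Cons (supported_on T) ?L" by blast
  qed
  ultimately show ?case by (simp add: bij_betw_def)
qed

section \<open>Monomial ideals and Stanley spaces\<close>

lemma keys_monom [simp]: "Poly_Mapping.keys (monom t :: ('n, 'k::field) polynomial) = {t}"
  by (simp add: monom_def)

lemma inj_monom: "inj (monom :: 'n exponent \<Rightarrow> ('n, 'k::field) polynomial)"
  by (metis injI keys_monom singleton_inject)

lemma lookup_times_monom:
  fixes f :: "('n, 'k::field) polynomial"
  shows "Poly_Mapping.lookup (f * monom t) (s + t) = Poly_Mapping.lookup f s"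
proof -
  have "Poly_Mapping.lookup (f * monom t) (s + t) =
      (\<Sum>k\<in>Poly_Mapping.keys f. Poly_Mapping.lookup
        (Poly_Mapping.single k (Poly_Mapping.lookup f k) * monom t) (s + t))"
    by (subst poly_mapping_eq_sum_single[of f, symmetric])
      (simp only: sum_distrib_right lookup_sum)
  \<comment> \<open>Cancelling \<open>t\<close> shows that only the term with exponent
    \<open>s\<close> contributes at \<open>s + t\<close>.\<close>
  also have "\<dots> = (\<Sum>k\<in>Poly_Mapping.keys f. if k = s then Poly_Mapping.lookup f s else 0)"
    by (intro sum.cong refl) (simp add: monom_def mult_single lookup_single when_def)
  also have "\<dots> = Poly_Mapping.lookup f s" by (simp add: in_keys_iff)
  finally show ?thesis .
qed

text \<open>Supplies the freeness condition for every space generated by a monomial.\<close>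

lemma times_monom_eq_0_iff:
  fixes f :: "('n, 'k::field) polynomial"
  shows "f * monom t = 0 \<longleftrightarrow> f = 0"
  by (metis lookup_times_monom lookup_zero mult_zero_left poly_mapping_eqI)

lemma keys_times_monom_subset:
  "Poly_Mapping.keys (f * monom t) \<subseteq> (\<lambda>s. s + t) ` Poly_Mapping.keys f"
  using keys_mult[of f "monom t"] by auto

text \<open>The exponents occurring in the Stanley space of \<open>monom t\<close> and
  \<open>Z\<close>; for \<open>Z = UNIV\<close> they are those of all multiples of
  \<open>monom t\<close>.\<close>

definition cone :: "'n exponent \<Rightarrow> 'n set \<Rightarrow> 'n exponent set" where
  "cone t Z = (\<lambda>u. u + t) ` {u. Poly_Mapping.keys u \<subseteq> Z}"

lemma mem_coneI: "t \<in> cone t Z"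
  by (auto simp: cone_def intro!: image_eqI[of _ _ 0])

lemma stanley_space_monom:
  "stanley_space (*) (monom t :: ('n, 'k::field) polynomial, Z) = supported_on (cone t Z)"
proof (intro equalityI subsetI)
  fix f :: "('n, 'k) polynomial"
  assume "f \<in> stanley_space (*) (monom t, Z)"
  then obtain g where "f = g * monom t" "g \<in> poly_subring Z"
    by (auto simp: stanley_space_def)
  then show "f \<in> supported_on (cone t Z)"
    using keys_times_monom_subset[of g t]
    by (fastforce simp: supported_on_def cone_def poly_subring_def)
next
  fix f :: "('n, 'k) polynomial"
  assume f: "f \<in> supported_on (cone t Z)"
  have inj: "inj (\<lambda>s. s + t)" by (simp add: inj_def)
  \<comment> \<open>The quotient of \<open>f\<close> by \<open>monom t\<close>: coefficients are
    shifted back along an injective map whose range contains every exponent of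
    \<open>f\<close>.\<close>
  define g where "g = Poly_Mapping.map_key (\<lambda>s. s + t) f"
  have g: "Poly_Mapping.lookup g s = Poly_Mapping.lookup f (s + t)" for s
    by (simp add: g_def map_key.rep_eq[OF inj])
  have "g \<in> poly_subring Z"
    unfolding poly_subring_def
  proof (intro CollectI ballI)
    fix s assume "s \<in> Poly_Mapping.keys g"
    then have "s + t \<in> cone t Z"
      using f by (auto simp: supported_on_def in_keys_iff g)
    then show "Poly_Mapping.keys s \<subseteq> Z" by (auto simp: cone_def)
  qed
  moreover have "g * monom t = f"
  proof (rule poly_mapping_eqI)
    fix k
    show "Poly_Mapping.lookup (g * monom t) k = Poly_Mapping.lookup f k"
    proof (cases "k \<in> range (\<lambda>s. s + t)")
      case True
      then show ?thesis by (auto simp: lookup_times_monom g)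
    next
      case False
      then have "k \<notin> Poly_Mapping.keys (g * monom t)" "k \<notin> Poly_Mapping.keys f"
        using f keys_times_monom_subset[of g t] by (auto simp: supported_on_def cone_def)
      then show ?thesis by (simp add: in_keys_iff)
    qed
  qed
  ultimately show "f \<in> stanley_space (*) (monom t, Z)" by (auto simp: stanley_space_def)
qed

text \<open>Cones over \<open>UNIV\<close> absorb the addition of any exponent, which makes the
  right-hand side an ideal; conversely, each term of a polynomial in it is a multiple of a
  generator.\<close>

lemma ideal_span_monom:
  "ideal.span (monom ` T :: ('n, 'k::field) polynomial set) = supported_on (\<Union>t\<in>T. cone t UNIV)"
    (is "_ = supported_on ?U")
proof
  have "ideal.subspace (supported_on ?U :: ('n, 'k) polynomial set)"
  proof (rule ideal.subspaceI)
    fix f g :: "('n, 'k) polynomial"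
    show "f + g \<in> supported_on ?U" if "f \<in> supported_on ?U" "g \<in> supported_on ?U"
      using supported_on_add[OF that] by simp
    show "f * g \<in> supported_on ?U" if g: "g \<in> supported_on ?U"
    proof -
      have "a + b \<in> ?U" if "b \<in> Poly_Mapping.keys g" for a b
      proof -
        from that g obtain t u where "t \<in> T" "b = u + t"
          by (auto simp: supported_on_def cone_def)
        then have "a + b = (a + u) + t" by (simp add: add.assoc)
        with \<open>t \<in> T\<close> show ?thesis unfolding cone_def by blast
      qed
      then have "{a + b |a b. a \<in> Poly_Mapping.keys f \<and> b \<in> Poly_Mapping.keys g} \<subseteq> ?U"
        by auto
      with keys_mult[of f g] show ?thesis
        unfolding supported_on_def by (auto dest: subset_trans)
    qed
  qed (simp add: supported_on_def)
  moreover have "monom ` T \<subseteq> (supported_on ?U :: ('n, 'k) polynomial set)"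
    by (auto simp: supported_on_def intro: mem_coneI)
  ultimately show "ideal.span (monom ` T) \<subseteq> (supported_on ?U :: ('n, 'k) polynomial set)"
    by (intro ideal.span_minimal)
next
  show "supported_on ?U \<subseteq> ideal.span (monom ` T :: ('n, 'k) polynomial set)"
  proof
    fix f :: "('n, 'k) polynomial"
    assume f: "f \<in> supported_on ?U"
    have "Poly_Mapping.single k c \<in> ideal.span (monom ` T)"
      if "k \<in> Poly_Mapping.keys f" for k and c :: 'k
    proof -
      from that f obtain t u where "t \<in> T" "k = u + t"
        by (auto simp: supported_on_def cone_def)
      then have "Poly_Mapping.single k c = Poly_Mapping.single u c * monom t"
        by (simp add: monom_def mult_single)
      then show ?thesis using \<open>t \<in> T\<close> by (simp add: ideal.span_scale ideal.span_base)
    qed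
    then have "(\<Sum>k\<in>Poly_Mapping.keys f. Poly_Mapping.single k (Poly_Mapping.lookup f k))
        \<in> ideal.span (monom ` T)"
      by (intro ideal.span_sum)
    then show "f \<in> ideal.span (monom ` T)" by (simp only: poly_mapping_eq_sum_single)
  qed
qed

lemma monom_mem_ideal_span_iff:
  "(monom s :: ('n, 'k::field) polynomial) \<in> ideal.span (monom ` T) \<longleftrightarrow>
    (\<exists>t\<in>T. s \<in> cone t UNIV)"
  by (simp add: ideal_span_monom supported_on_def)

text \<open>Since \<open>slength\<close> is an infimum, exhibiting one decomposition bounds it;
  disjoint cones covering the exponents of \<open>I\<close> provide one.\<close>

lemma ideal_slength_le_cones:
  fixes D :: "('n exponent \<times> 'n set) list"
  assumes "sorted_wrt (\<lambda>S T. S \<inter> T = {}) (map (case_prod cone) D)"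
    and I: "I = supported_on (\<Union>(t, Z)\<in>set D. cone t Z)"
  shows "ideal_slength (I :: ('n, 'k::field) polynomial set) \<le> enat (length D)"
proof -
  let ?m = "\<lambda>(t, Z). (monom t :: ('n, 'k) polynomial, Z)"
  have spaces: "map (stanley_space (*)) (map ?m D) = map supported_on (map (case_prod cone) D)"
    by (simp add: stanley_space_monom split_def)
  have "bij_betw sum_list (listset (map (stanley_space (*)) (map ?m D))) I"
    using bij_betw_sum_list_supported_on[OF assms(1), where 'b = 'k] unfolding spaces I by simp
  moreover have "monom t \<in> I" if "(t, Z) \<in> set D" for t Z
    using that by (auto simp: I supported_on_def intro: mem_coneI)
  moreover have
    "(monom t :: ('n, 'k) polynomial) \<in> polynomial_component (\<lambda>i. int (Poly_Mapping.lookup t i))"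
    for t by (simp add: polynomial_component_def)
  ultimately have "stanley_decomposition (*) I (\<lambda>a. I \<inter> polynomial_component a) (map ?m D)"
    unfolding stanley_decomposition_def by (auto simp: times_monom_eq_0_iff)
  then show ?thesis
    unfolding ideal_slength_def slength_def by (intro INF_lower2[of "map ?m D"]) auto
qed

section \<open>Squarefree exponents\<close>

text \<open>Finiteness of the type matters: a sum over an infinite \<open>A\<close> would default to
  0.\<close>

definition indicator_exponent :: "'n set \<Rightarrow> 'n::finite exponent" where
  "indicator_exponent A = (\<Sum>i\<in>A. Poly_Mapping.single i 1)"

lemma lookup_indicator_exponent:
  "Poly_Mapping.lookup (indicator_exponent A) i = (if i \<in> A then 1 else 0)"
  by (simp add: indicator_exponent_def lookup_sum lookup_single when_def)

lemma squarefree_exponent_eq_indicator: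
  fixes t :: "'n::finite exponent"
  assumes "squarefree_exponent t"
  shows "t = indicator_exponent (Poly_Mapping.keys t)"
proof (rule poly_mapping_eqI)
  fix i
  have "Poly_Mapping.lookup t i \<le> 1" using assms by (simp add: squarefree_exponent_def)
  then show "Poly_Mapping.lookup t i =
      Poly_Mapping.lookup (indicator_exponent (Poly_Mapping.keys t)) i"
    by (auto simp: lookup_indicator_exponent in_keys_iff)
qed

text \<open>Passes from exponents to supports: adding this exponent joins \<open>A\<close> to the
  support, so a cone becomes the preimage under \<open>keys\<close> of an interval of sets.\<close>

lemma cone_indicator_exponent:
  assumes "A \<subseteq> Z"
  shows "cone (indicator_exponent A) Z =
    {s. A \<subseteq> Poly_Mapping.keys s \<and> Poly_Mapping.keys s \<subseteq> Z}"
  (is "_ = ?S")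
proof (intro equalityI subsetI)
  fix s assume "s \<in> cone (indicator_exponent A) Z"
  then obtain u where "s = u + indicator_exponent A" "Poly_Mapping.keys u \<subseteq> Z"
    by (auto simp: cone_def)
  moreover have "Poly_Mapping.keys (u + indicator_exponent A) = Poly_Mapping.keys u \<union> A"
    by (auto simp: in_keys_iff lookup_add lookup_indicator_exponent)
  ultimately show "s \<in> ?S"
    using assms by auto
next
  fix s assume s: "s \<in> ?S"
  \<comment> \<open>Truncated subtraction is exact here because \<open>s\<close> is at least 1 on
    \<open>A\<close>.\<close>
  have "s = (s - indicator_exponent A) + indicator_exponent A"
    using s by (intro poly_mapping_eqI)
      (auto simp: lookup_add lookup_minus lookup_indicator_exponent in_keys_iff Suc_le_eq)
  moreover have "Poly_Mapping.keys (s - indicator_exponent A) \<subseteq> Z"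
    using s by (auto simp: in_keys_iff lookup_minus)
  ultimately show "s \<in> cone (indicator_exponent A) Z" unfolding cone_def by blast
qed

text \<open>
  Each minimal generator is a multiple of a squarefree monomial of \<open>I\<close>, which in turn is a
  multiple of a minimal generator.
\<close>

lemma minimal_generators_squarefree:
  fixes I :: "('n::finite, 'k::field) polynomial set"
  assumes "squarefree_monomial_ideal I" and "minimally_generated_by_monomials I (monom ` P)"
    and p: "p \<in> P"
  shows "squarefree_exponent p"
proof -
  from assms(1) obtain T where T: "\<forall>t\<in>T. squarefree_exponent t"
    and I_T: "I = ideal.span (monom ` T)" unfolding squarefree_monomial_ideal_def by blast
  have I_P: "ideal.span (monom ` P) = I"
    and minimal: "\<And>G'. G' \<subset> monom ` P \<Longrightarrow> ideal.span G' \<noteq> I"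
    using assms(2) by (auto simp: minimally_generated_by_monomials_def)
  have "monom p \<in> I" using p I_P ideal.span_base by blast
  then obtain t u where t: "t \<in> T" "p = u + t"
    unfolding I_T monom_mem_ideal_span_iff by (auto simp: cone_def)
  have "monom t \<in> I" using t I_T ideal.span_base by blast
  then obtain q v where q: "q \<in> P" "t = v + q"
    unfolding I_P[symmetric] monom_mem_ideal_span_iff by (auto simp: cone_def)
  have p_q: "p = (u + v) + q" using t q by (simp add: add.assoc)
  have "q = p"
  proof (rule ccontr)
    assume "q \<noteq> p"
    \<comment> \<open>If \<open>q\<close> differed from \<open>p\<close>, then \<open>p\<close>,
      being a multiple of \<open>q\<close>, would be a redundant generator.\<close>
    let ?G = "monom ` (P - {p}) :: ('n, 'k) polynomial set"
    have "p \<in> cone q UNIV" using p_q by (auto simp: cone_def)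
    then have "monom p \<in> ideal.span ?G"
      using q \<open>q \<noteq> p\<close> by (auto simp: monom_mem_ideal_span_iff)
    then have "monom ` P \<subseteq> ideal.span ?G" by (auto intro: ideal.span_base)
    then have "ideal.span (monom ` P) \<subseteq> ideal.span ?G"
      by (rule ideal.span_minimal) (rule ideal.subspace_span)
    moreover have "ideal.span ?G \<subseteq> ideal.span (monom ` P)" by (rule ideal.span_mono) auto
    moreover have "monom p \<notin> ?G" by (simp add: inj_image_mem_iff[OF inj_monom])
    then have "?G \<subset> monom ` P" using p by blast
    ultimately show False using minimal I_P by blast
  qed
  \<comment> \<open>Natural numbers with sum 0 vanish, so \<open>p\<close> equals the squarefree
    \<open>t\<close>.\<close>
  with p_q have "u + v = 0" by (metis add_cancel_left_left)
  then have "Poly_Mapping.lookup u i + Poly_Mapping.lookup v i = 0" for i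
    by (metis lookup_add lookup_zero)
  then have "u = 0" by (intro poly_mapping_eqI) simp
  with t T show ?thesis by simp
qed

section \<open>The cyclic partition\<close>

text \<open>A pair \<open>(M, Z)\<close> encodes the interval \<open>{M..Z}\<close> of supports. The
  argument \<open>A\<close> accumulates the list elements already passed, which must be present in
  all later intervals.\<close>

fun first_missing :: "'n set \<Rightarrow> 'n list \<Rightarrow> ('n set \<times> 'n set) list" where
  "first_missing A [] = []"
| "first_missing A (b # bs) = (A, - {b}) # first_missing (insert b A) bs"

lemma length_first_missing [simp]: "length (first_missing A bs) = length bs"
  by (induction bs arbitrary: A) auto

text \<open>The hypotheses keep each \<open>b\<close> out of the accumulated lower bound, so every
  interval is nonempty, as \<open>cone_indicator_exponent\<close> requires.\<close>

lemma first_missing_subset: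
  "distinct bs \<Longrightarrow> A \<inter> set bs = {} \<Longrightarrow> \<forall>(M, Z)\<in>set (first_missing A bs). M \<subseteq> Z"
proof (induction bs arbitrary: A)
  case (Cons b bs)
  then have "\<forall>(M, Z)\<in>set (first_missing (insert b A) bs). M \<subseteq> Z" by (intro Cons.IH) auto
  with Cons.prems show ?case by auto
qed simp

lemma Union_first_missing:
  "\<Union>(set (map (\<lambda>(M, Z). {M..Z}) (first_missing A bs))) = {X. A \<subseteq> X \<and> \<not> set bs \<subseteq> X}"
proof (induction bs arbitrary: A)
  case (Cons b bs)
  show ?case
    unfolding first_missing.simps list.map list.set Union_insert Cons.IH by auto
qed simp

lemma disjoint_Union_memberD:
  "S \<inter> \<Union>\<T> = {} \<Longrightarrow> T \<in> \<T> \<Longrightarrow> S \<inter> T = {}"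
  by blast

lemma sorted_wrt_first_missing:
  "sorted_wrt (\<lambda>S T. S \<inter> T = {}) (map (\<lambda>(M, Z). {M..Z}) (first_missing A bs))"
proof (induction bs arbitrary: A)
  case (Cons b bs)
  \<comment> \<open>Sets in the first interval omit \<open>b\<close>, whereas all later ones contain
    it.\<close>
  have disj: "{A..- {b}} \<inter>
      \<Union>(set (map (\<lambda>(M, Z). {M..Z}) (first_missing (insert b A) bs))) = {}"
    unfolding Union_first_missing by auto
  show ?case
    unfolding first_missing.simps list.map sorted_wrt.simps prod.case
    using disj by (intro conjI ballI Cons.IH) (rule disjoint_Union_memberD)
qed simp

text \<open>If \<open>X\<close> contains some but not all of the three sets, then going round the
  cycle there is exactly one change from contained to not contained; this makes the three cyclic
  classes disjoint and exhaustive.\<close>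

lemma cyclic_interval_partition:
  fixes A B C :: "'n::finite set"
  obtains D :: "('n set \<times> 'n set) list"
  where "length D \<le> CARD('n) + 1"
    and "\<forall>(M, Z)\<in>set D. M \<subseteq> Z"
    and "sorted_wrt (\<lambda>S T. S \<inter> T = {}) (map (\<lambda>(M, Z). {M..Z}) D)"
    and "(\<Union>(M, Z)\<in>set D. {M..Z}) = {X. A \<subseteq> X \<or> B \<subseteq> X \<or> C \<subseteq> X}"
proof -
  obtain bs where bs: "set bs = B - A" "distinct bs"
    using finite_distinct_list[of "B - A"] by auto
  obtain cs where cs: "set cs = C - B" "distinct cs"
    using finite_distinct_list[of "C - B"] by auto
  obtain as where as: "set as = A - C" "distinct as"
    using finite_distinct_list[of "A - C"] by auto
  let ?D = "(A \<union> B \<union> C, UNIV) #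
    first_missing A bs @ first_missing B cs @ first_missing C as"
  let ?i = "\<lambda>(M, Z). {M..Z}"
  \<comment> \<open>Given \<open>A \<subseteq> X\<close>, containing \<open>B\<close> amounts to
    containing \<open>B - A\<close>; likewise for the other two.\<close>
  have U: "\<Union>(set (map ?i (first_missing A bs))) = {X. A \<subseteq> X \<and> \<not> B \<subseteq> X}"
    "\<Union>(set (map ?i (first_missing B cs))) = {X. B \<subseteq> X \<and> \<not> C \<subseteq> X}"
    "\<Union>(set (map ?i (first_missing C as))) = {X. C \<subseteq> X \<and> \<not> A \<subseteq> X}"
    unfolding Union_first_missing bs cs as by auto
  show thesis
  proof
    have "length ?D = card (B - A) + card (C - B) + card (A - C) + 1"
      using distinct_card[OF bs(2)] distinct_card[OF cs(2)] distinct_card[OF as(2)] bs cs as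
      by simp
    also have "card (B - A) + card (C - B) + card (A - C) = card ((B - A) \<union> (C - B) \<union> (A - C))"
      by (subst card_Un_disjoint; auto)+
    also have "\<dots> \<le> CARD('n)" by (intro card_mono) auto
    finally show "length ?D \<le> CARD('n) + 1" by simp
    have "\<forall>(M, Z)\<in>set (first_missing A bs). M \<subseteq> Z"
      "\<forall>(M, Z)\<in>set (first_missing B cs). M \<subseteq> Z"
      "\<forall>(M, Z)\<in>set (first_missing C as). M \<subseteq> Z"
      using bs cs as by (intro first_missing_subset; simp)+
    then show "\<forall>(M, Z)\<in>set ?D. M \<subseteq> Z" by (simp add: ball_Un)
    have "\<Union>(set (map ?i ?D)) = {X. A \<subseteq> X \<or> B \<subseteq> X \<or> C \<subseteq> X}"
      unfolding list.map map_append list.set set_append Union_insert Union_Un_distrib U by auto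
    then show "(\<Union>(M, Z)\<in>set ?D. {M..Z}) = {X. A \<subseteq> X \<or> B \<subseteq> X \<or> C \<subseteq> X}" by simp
    show "sorted_wrt (\<lambda>S T. S \<inter> T = {}) (map ?i ?D)"
      unfolding list.map map_append sorted_wrt.simps sorted_wrt_append
    proof (intro conjI ballI sorted_wrt_first_missing)
      let ?R = "set (map ?i (first_missing A bs) @ map ?i (first_missing B cs) @
        map ?i (first_missing C as))"
      fix T assume "T \<in> ?R"
      moreover have "?i (A \<union> B \<union> C, UNIV) \<inter> \<Union>?R = {}"
        unfolding set_append Union_Un_distrib U by auto
      ultimately show "?i (A \<union> B \<union> C, UNIV) \<inter> T = {}"
        by (rule disjoint_Union_memberD[rotated])
    next
      fix S T assume "S \<in> set (map ?i (first_missing B cs))"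
        "T \<in> set (map ?i (first_missing C as))"
      then have "S \<subseteq> {X. B \<subseteq> X \<and> \<not> C \<subseteq> X}" "T \<subseteq> {X. C \<subseteq> X \<and> \<not> A \<subseteq> X}"
        unfolding U[symmetric] by (auto simp only: Union_upper)
      then show "S \<inter> T = {}" by blast
    next
      \<comment> \<open>The two alternatives for \<open>T\<close> conflict with \<open>S\<close>
        over \<open>B\<close> and over \<open>A\<close>, respectively.\<close>
      fix S T assume "S \<in> set (map ?i (first_missing A bs))"
        "T \<in> set (map ?i (first_missing B cs) @ map ?i (first_missing C as))"
      then have "S \<subseteq> {X. A \<subseteq> X \<and> \<not> B \<subseteq> X}"
        "T \<subseteq> {X. B \<subseteq> X \<and> \<not> C \<subseteq> X} \<or> T \<subseteq> {X. C \<subseteq> X \<and> \<not> A \<subseteq> X}"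
        unfolding U[symmetric] set_append by (auto simp only: Union_upper Un_iff)
      then show "S \<inter> T = {}" by blast
    qed
  qed
qed

section \<open>From intervals of supports back to the ideal\<close>

theorem proposition3p11:
  fixes I G :: "('n::finite, 'k::field) polynomial set"
  assumes "squarefree_monomial_ideal I"
    and "minimally_generated_by_monomials I G"
    and "card G = 3"
  shows "ideal_slength I \<le> enat (CARD('n) + 1)"
proof -
  obtain P where G: "G = monom ` P"
    using assms(2) by (auto simp: minimally_generated_by_monomials_def subset_image_iff)
  have "card P = 3" using assms(3) inj_monom card_image inj_on_subset unfolding G
    by (metis subset_UNIV)
  then obtain p q r where P: "P = {p, q, r}" by (auto simp: card_3_iff)
  have sf: "s = indicator_exponent (Poly_Mapping.keys s)" if "s \<in> P" for s
    using minimal_generators_squarefree[OF assms(1) assms(2)[unfolded G] that]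
    by (rule squarefree_exponent_eq_indicator)
  have cone: "cone s UNIV = {t. Poly_Mapping.keys s \<subseteq> Poly_Mapping.keys t}" if "s \<in> P" for s
    using cone_indicator_exponent[of "Poly_Mapping.keys s" UNIV] sf[OF that] by simp
  obtain D where len: "length D \<le> CARD('n) + 1"
    and sub: "\<forall>(M, Z)\<in>set D. M \<subseteq> Z"
    and disj: "sorted_wrt (\<lambda>S T. S \<inter> T = {}) (map (\<lambda>(M, Z). {M..Z}) D)"
    and union: "(\<Union>(M, Z)\<in>set D. {M..Z}) =
      {X. Poly_Mapping.keys p \<subseteq> X \<or> Poly_Mapping.keys q \<subseteq> X \<or> Poly_Mapping.keys r \<subseteq> X}"
    by (rule cyclic_interval_partition
        [of "Poly_Mapping.keys p" "Poly_Mapping.keys q" "Poly_Mapping.keys r"])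
  let ?E = "map (\<lambda>(M, Z). (indicator_exponent M, Z)) D"
  have cell: "cone (indicator_exponent M) Z = Poly_Mapping.keys -` {M..Z}"
    if "(M, Z) \<in> set D" for M Z
    using cone_indicator_exponent[of M Z] sub that by auto
  have cells: "map (case_prod cone) ?E = map (vimage Poly_Mapping.keys) (map (\<lambda>(M, Z). {M..Z}) D)"
    using cell by auto
  \<comment> \<open>Preimages under \<open>keys\<close> of disjoint intervals are disjoint, so the
    partition of supports lifts to exponents.\<close>
  have "sorted_wrt (\<lambda>S T. S \<inter> T = {})
      (map (vimage Poly_Mapping.keys) (map (\<lambda>(M, Z). {M..Z}) D))"
    unfolding sorted_wrt_map[of _ "vimage Poly_Mapping.keys"]
    using disj by (rule sorted_wrt_mono_rel[rotated]) auto
  then have "sorted_wrt (\<lambda>S T. S \<inter> T = {}) (map (case_prod cone) ?E)" unfolding cells .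
  moreover have "I = supported_on (\<Union>(t, Z)\<in>set ?E. cone t Z)"
  proof -
    have "(\<Union>(t, Z)\<in>set ?E. cone t Z) = \<Union>(set (map (case_prod cone) ?E))" by simp
    also have "\<dots> = Poly_Mapping.keys -` (\<Union>(M, Z)\<in>set D. {M..Z})"
      unfolding cells by (simp add: vimage_UN image_image)
    \<comment> \<open>Divisibility by a squarefree generator depends only on supports.\<close>
    also have "\<dots> = (\<Union>s\<in>P. cone s UNIV)"
      unfolding union using cone by (auto simp: P)
    finally show ?thesis
      using assms(2) ideal_span_monom[of P, where 'k = 'k]
      by (simp add: minimally_generated_by_monomials_def G)
  qed
  ultimately have "ideal_slength I \<le> enat (length ?E)" by (rule ideal_slength_le_cones)
  also have "\<dots> \<le> enat (CARD('n) + 1)" using len by simp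
  finally show ?thesis .
qed

end
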